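(* Let $S_N\subset G\subset U_N^+$ be a homogeneous quantum group, and denote by $\Gamma=\widehat G$ its discrete quantum group dual. (1) If $\Gamma$ has presentation level $r<\infty$, then $G$ has easiness level $p\leq B_r$, where $B_r$ is the $r$-th Bell number. (2) In particular, if $\Gamma$ is finitely presented, then $G$ has finite easiness level.
   Context: Compact quantum groups. $C(U_N^+)$ is the universal $C^*$-algebra generated by the entries of an $N\times N$ matrix $u=(u_{ij})$ subject to $u^*=u^{-1}$, $u^t=\bar u^{-1}$, with $\Delta(u_{ij})=\sum_ku_{ik}\otimes u_{kj}$, $\varepsilon(u_{ij})=\delta_{ij}$, $S(u_{ij})=u_{ji}^*$. A closed subgroup $G\subset U_N^+$ is a quotient $C(G)$ of $C(U_N^+)$ to which these maps descend. $G$ is homogeneous if $S_N\subset G\subset U_N^+$, where $S_N\subset U_N\subset U_N^+$ via the permutation matrices. Tannakian categories. Colored integers are finite words in $\circ,\bullet$; $u^{\otimes k}$ is defined by $u^\circ=u$, $u^\bullet=\bar u=(u_{ij}^* )$ and multiplicativity. The Tannakian category of $G$ is $C=(C(k,l))$, $C(k,l)=Hom(u^{\otimes k},u^{\otimes l})$, and $Fix(u^{\otimes k})=C(\emptyset,k)$. A tensor category here is a family of linear spaces $C(k,l)\subset\mathcal L((\mathbb C^N)^{\otimes k},(\mathbb C^N)^{\otimes l})$, stable under tensor products, composition and adjoints, containing the identities and the duality maps $1\mapsto\sum_ie_i\otimes e_i$ in $C(\emptyset,\circ\bullet)$ and $C(\emptyset,\bullet\circ)$; $<\cdot>$ denotes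 the generated tensor category. Closed subgroups of $U_N^+$ correspond bijectively to such categories. Presentation level. The presentation level of the discrete quantum group dual $\Gamma=\widehat G$ is the smallest $r\in\mathbb N\cup\{\infty\}$ such that $C=<Fix(u^{\otimes r})>$ (tensor powers of total length $r$). $\Gamma$ is finitely presented when $r<\infty$. Easiness level. $P(k,l)$ is the set of partitions of an upper row of points colored by $k$ and a lower row of points colored by $l$. For $\pi\in P(k,l)$, $T_\pi(e_{i_1}\otimes\ldots\otimes e_{i_k})=\sum_{j_1\ldots j_l}\delta_\pi(i;j)\,e_{j_1}\otimes\ldots\otimes e_{j_l}$, where $\delta_\pi(i;j)=1$ if each block of $\pi$ contains equal indices, and $0$ otherwise. For $p\in\mathbb N$, let $E^p(k,l)=\{\alpha_1T_{\pi_1}+\ldots+\alpha_pT_{\pi_p}\in C(k,l)\,|\,\alpha_i\in\mathbb C,\pi_i\in P(k,l)\}$, let $C^p$ be the smallest tensor category containing all the sets $E^p(k,l)$, and let $G^p$ be the quantum group with Tannakian category $C^p$. The easiness level of $G$ is the smallest $p\in\mathbb N\cup\{\infty\}$ such that $G=G^p$, with $p=\infty$ if $G\neq G^p$ for all $p\in\mathbb N$. The Bell number $B_r$ is the number of partitions of a set with $r$ elements. *)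

theory Defs
  imports
    "HOL-Analysis.Analysis"
    "HOL-Library.Disjoint_Sets"
    "HOL-Library.Extended_Nat"
    "HOL-Combinatorics.Permutations"
begin

section \<open>Unital C*-algebras\<close>

class unital_cstar_algebra = real_normed_algebra_1 + banach +
  fixes scaleC :: "complex \<Rightarrow> 'a \<Rightarrow> 'a"  (infixr "*\<^sub>C" 75)
    and star :: "'a \<Rightarrow> 'a"
  assumes scaleR_eq_scaleC: "scaleR r x = complex_of_real r *\<^sub>C x"
    and scaleC_add_right: "c *\<^sub>C (x + y) = c *\<^sub>C x + c *\<^sub>C y"
    and scaleC_add_left: "(c + d) *\<^sub>C x = c *\<^sub>C x + d *\<^sub>C x"
    and scaleC_scaleC: "c *\<^sub>C d *\<^sub>C x = (c * d) *\<^sub>C x"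
    and scaleC_one: "1 *\<^sub>C x = x"
    and mult_scaleC_left: "(c *\<^sub>C x) * y = c *\<^sub>C (x * y)"
    and mult_scaleC_right: "x * (c *\<^sub>C y) = c *\<^sub>C (x * y)"
    and norm_scaleC: "norm (c *\<^sub>C x) = cmod c * norm x"
    and star_add: "star (x + y) = star x + star y"
    and star_scaleC: "star (c *\<^sub>C x) = cnj c *\<^sub>C star x"
    and star_mult: "star (x * y) = star y * star x"
    and star_star: "star (star x) = x"
    and cstar_identity: "norm (star x * x) = (norm x)\<^sup>2"

instantiation complex :: unital_cstar_algebra
begin

definition scaleC_complex :: "complex \<Rightarrow> complex \<Rightarrow> complex"
  where "scaleC_complex c x = c * x"

definition star_complex :: "complex \<Rightarrow> complex"
  where "star_complex = cnj"

instance
  by standard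
    (simp_all add: scaleC_complex_def star_complex_def algebra_simps norm_mult
      scaleR_conv_of_real power2_eq_square)

end

global_interpretation cvec: vector_space "scaleC :: complex \<Rightarrow> 'a \<Rightarrow> 'a::unital_cstar_algebra"
  by standard (simp_all add: scaleC_add_right scaleC_add_left scaleC_scaleC scaleC_one)

text \<open>Continuity is not required: such maps are automatically contractive.\<close>

definition star_hom :: "('a::unital_cstar_algebra \<Rightarrow> 'b::unital_cstar_algebra) \<Rightarrow> bool" where
  "star_hom f \<longleftrightarrow>
     (\<forall>x y. f (x + y) = f x + f y) \<and> (\<forall>c x. f (c *\<^sub>C x) = c *\<^sub>C f x) \<and>
     (\<forall>x y. f (x * y) = f x * f y) \<and> f 1 = 1 \<and> (\<forall>x. f (star x) = star (f x))"

definition star_antihom :: "('a::unital_cstar_algebra \<Rightarrow> 'b::unital_cstar_algebra) \<Rightarrow> bool" where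
  "star_antihom f \<longleftrightarrow>
     (\<forall>x y. f (x + y) = f x + f y) \<and> (\<forall>c x. f (c *\<^sub>C x) = c *\<^sub>C f x) \<and>
     (\<forall>x y. f (x * y) = f y * f x) \<and> f 1 = 1 \<and> (\<forall>x. f (star x) = star (f x))"

definition cstar_subalgebra :: "'a::unital_cstar_algebra set \<Rightarrow> bool" where
  "cstar_subalgebra B \<longleftrightarrow>
     cvec.subspace B \<and> 1 \<in> B \<and> (\<forall>x\<in>B. \<forall>y\<in>B. x * y \<in> B) \<and> (\<forall>x\<in>B. star x \<in> B) \<and> closed B"

text \<open>\<open>cstar_tensor_product t\<close> says that the type \<open>'b\<close> is a C*-tensor product of \<open>'a\<close> with itself,
  \<open>t\<close> being \<open>(a, b) \<mapsto> a \<otimes> b\<close>: the algebraic tensor product embeds as a dense *-subalgebra.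
  The C*-norm on the algebraic tensor product is left arbitrary.\<close>

locale cstar_tensor_product =
  fixes t :: "'a::unital_cstar_algebra \<Rightarrow> 'a \<Rightarrow> 'b::unital_cstar_algebra"
  assumes add_left: "t (x + y) z = t x z + t y z"
    and add_right: "t x (y + z) = t x y + t x z"
    and scale_left: "t (c *\<^sub>C x) y = c *\<^sub>C t x y"
    and scale_right: "t x (c *\<^sub>C y) = c *\<^sub>C t x y"
    and mult: "t x y * t x' y' = t (x * x') (y * y')"
    and unit: "t 1 1 = 1"
    and star: "star (t x y) = t (star x) (star y)"
    and inj: "\<lbrakk>finite X; cvec.independent X; (\<Sum>x\<in>X. t x (f x)) = 0; x \<in> X\<rbrakk> \<Longrightarrow> f x = 0"
    and dense: "closure (cvec.span {t x y | x y. True}) = UNIV"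

section \<open>Closed subgroups of \<open>U\<^sub>N\<^sup>+\<close>\<close>

text \<open>Here \<open>N = CARD('n)\<close>, and \<open>C(G)\<close> is the type \<open>'a\<close>. By the universal property of \<open>C(U\<^sub>N\<^sup>+)\<close>,
  its quotients are the C*-algebras generated by the entries of a matrix \<open>u\<close> satisfying the
  relations \<open>u\<^sup>* = u\<^sup>-\<^sup>1\<close>, \<open>u\<^sup>t = \<^bold>u\<^sup>-\<^sup>1\<close> (where \<open>\<^bold>u\<close> is the entrywise adjoint). The structure maps of
  \<open>U\<^sub>N\<^sup>+\<close> descend to such a quotient iff there are morphisms \<open>\<Delta>\<close>, \<open>\<epsilon>\<close>, \<open>S\<close> with the prescribed
  values on the generators.\<close>

locale closed_subgroup_UN_plus = cstar_tensor_product t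
  for t :: "'a::unital_cstar_algebra \<Rightarrow> 'a \<Rightarrow> 'b::unital_cstar_algebra" +
  fixes u :: "'n::finite \<Rightarrow> 'n \<Rightarrow> 'a"
    and \<Delta> :: "'a \<Rightarrow> 'b"
    and \<epsilon> :: "'a \<Rightarrow> complex"
    and S :: "'a \<Rightarrow> 'a"
  assumes u_ustar: "(\<Sum>k\<in>UNIV. u i k * star (u j k)) = of_bool (i = j)"
    and ustar_u: "(\<Sum>k\<in>UNIV. star (u k i) * u k j) = of_bool (i = j)"
    and ut_ubar: "(\<Sum>k\<in>UNIV. u k i * star (u k j)) = of_bool (i = j)"
    and ubar_ut: "(\<Sum>k\<in>UNIV. star (u i k) * u j k) = of_bool (i = j)"
    and generated: "\<lbrakk>cstar_subalgebra B; \<And>i j. u i j \<in> B\<rbrakk> \<Longrightarrow> B = UNIV"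
    and comult_hom: "star_hom \<Delta>"
    and comult: "\<Delta> (u i j) = (\<Sum>k\<in>UNIV. t (u i k) (u k j))"
    and counit_hom: "star_hom \<epsilon>"
    and counit: "\<epsilon> (u i j) = of_bool (i = j)"
    and antipode_hom: "star_antihom S"
    and antipode: "S (u i j) = star (u j i)"

text \<open>\<open>S\<^sub>N \<subseteq> G\<close>: there is a unital *-homomorphism \<open>C(G) \<rightarrow> C(S\<^sub>N)\<close> sending \<open>u\<^sub>i\<^sub>j\<close> to the \<open>(i,j)\<close>
  coordinate function on permutation matrices \<open>e\<^sub>j \<mapsto> e\<^bsub>\<sigma>(j)\<^esub>\<close>. The operations of \<open>C(S\<^sub>N)\<close> are
  pointwise, so the homomorphism property is tested at each permutation. Surjectivity is
  automatic, as the coordinates generate \<open>C(S\<^sub>N)\<close>.\<close>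

definition contains_SN :: "('n::finite \<Rightarrow> 'n \<Rightarrow> 'a::unital_cstar_algebra) \<Rightarrow> bool" where
  "contains_SN u \<longleftrightarrow>
     (\<exists>\<phi> :: 'a \<Rightarrow> ('n \<Rightarrow> 'n) \<Rightarrow> complex. \<forall>\<sigma>. \<sigma> permutes UNIV \<longrightarrow>
        star_hom (\<lambda>a. \<phi> a \<sigma>) \<and> (\<forall>i j. \<phi> (u i j) \<sigma> = of_bool (i = \<sigma> j)))"

section \<open>Tensor categories\<close>

datatype color = White | Black

type_synonym cint = "color list"

text \<open>A linear map \<open>(\<complex>\<^sup>N)\<^sup>\<otimes>\<^sup>k \<rightarrow> (\<complex>\<^sup>N)\<^sup>\<otimes>\<^sup>l\<close> is given by its matrix in the bases
  \<open>e\<^bsub>i\<^sub>1\<^esub> \<otimes> \<dots> \<otimes> e\<^bsub>i\<^sub>k\<^esub>\<close> indexed by lists; in \<open>T j i\<close>, the row index \<open>j\<close> comes first, so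
  \<open>T(e\<^sub>i) = \<Sum>\<^sub>j T j i e\<^sub>j\<close>. Matrices vanish at lists of the wrong length.\<close>

type_synonym 'n tmap = "'n list \<Rightarrow> 'n list \<Rightarrow> complex"

definition tmaps :: "cint \<Rightarrow> cint \<Rightarrow> 'n tmap set" where
  "tmaps k l = {T. \<forall>j i. T j i \<noteq> 0 \<longrightarrow> length j = length l \<and> length i = length k}"

definition multi_indices :: "cint \<Rightarrow> 'n list set" where
  "multi_indices k = {i. length i = length k}"

text \<open>In \<open>tm_comp l S T\<close>, \<open>l\<close> is the middle object; in \<open>tm_tensor k l T S\<close>, the first factor \<open>T\<close>
  goes from \<open>k\<close> to \<open>l\<close>.\<close>

definition tm_comp :: "cint \<Rightarrow> 'n::finite tmap \<Rightarrow> 'n tmap \<Rightarrow> 'n tmap" where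
  "tm_comp l S T = (\<lambda>j i. \<Sum>h\<in>multi_indices l. S j h * T h i)"

definition tm_tensor :: "cint \<Rightarrow> cint \<Rightarrow> 'n tmap \<Rightarrow> 'n tmap \<Rightarrow> 'n tmap" where
  "tm_tensor k l T S = (\<lambda>j i.
     T (take (length l) j) (take (length k) i) * S (drop (length l) j) (drop (length k) i))"

definition tm_adjoint :: "'n tmap \<Rightarrow> 'n tmap" where
  "tm_adjoint T = (\<lambda>j i. cnj (T i j))"

definition tm_id :: "cint \<Rightarrow> 'n tmap" where
  "tm_id k = (\<lambda>j i. of_bool (j = i \<and> length i = length k))"

definition tm_duality :: "'n tmap" where
  "tm_duality = (\<lambda>j i. of_bool (i = [] \<and> (\<exists>a. j = [a, a])))"

type_synonym 'n tfamily = "cint \<Rightarrow> cint \<Rightarrow> 'n tmap set"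

definition tensor_category :: "'n::finite tfamily \<Rightarrow> bool" where
  "tensor_category C \<longleftrightarrow>
     (\<forall>k l. C k l \<subseteq> tmaps k l) \<and>
     (\<forall>k l. (\<lambda>j i. 0) \<in> C k l) \<and>
     (\<forall>k l. \<forall>S\<in>C k l. \<forall>T\<in>C k l. (\<lambda>j i. S j i + T j i) \<in> C k l) \<and>
     (\<forall>k l c. \<forall>T\<in>C k l. (\<lambda>j i. c * T j i) \<in> C k l) \<and>
     (\<forall>k l k' l'. \<forall>T\<in>C k l. \<forall>S\<in>C k' l'. tm_tensor k l T S \<in> C (k @ k') (l @ l')) \<and>
     (\<forall>k l m. \<forall>T\<in>C k l. \<forall>S\<in>C l m. tm_comp l S T \<in> C k m) \<and>
     (\<forall>k l. \<forall>T\<in>C k l. tm_adjoint T \<in> C l k) \<and>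
     (\<forall>k. tm_id k \<in> C k k) \<and>
     tm_duality \<in> C [] [White, Black] \<and> tm_duality \<in> C [] [Black, White]"

definition generated_category :: "'n::finite tfamily \<Rightarrow> 'n tfamily" where
  "generated_category X k l =
     \<Inter> {C k l | C. tensor_category C \<and> (\<forall>k' l'. X k' l' \<subseteq> C k' l')}"

section \<open>The Tannakian category of a quantum group\<close>

fun colored_entry ::
  "('n \<Rightarrow> 'n \<Rightarrow> 'a::unital_cstar_algebra) \<Rightarrow> color \<Rightarrow> 'n \<Rightarrow> 'n \<Rightarrow> 'a" where
  "colored_entry u White i j = u i j"
| "colored_entry u Black i j = star (u i j)"

fun tensor_power ::
  "('n \<Rightarrow> 'n \<Rightarrow> 'a::unital_cstar_algebra) \<Rightarrow> cint \<Rightarrow> 'n list \<Rightarrow> 'n list \<Rightarrow> 'a" where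
  "tensor_power u [] [] [] = 1"
| "tensor_power u (c # k) (i # is) (j # js) = colored_entry u c i j * tensor_power u k is js"
| "tensor_power u _ _ _ = 0"

text \<open>\<open>C(k,l) = Hom(u\<^sup>\<otimes>\<^sup>k, u\<^sup>\<otimes>\<^sup>l)\<close>, the \<open>T\<close> satisfying \<open>T u\<^sup>\<otimes>\<^sup>k = u\<^sup>\<otimes>\<^sup>l T\<close>.\<close>

definition tannakian :: "('n::finite \<Rightarrow> 'n \<Rightarrow> 'a::unital_cstar_algebra) \<Rightarrow> 'n tfamily" where
  "tannakian u k l = {T \<in> tmaps k l. \<forall>j\<in>multi_indices l. \<forall>i\<in>multi_indices k.
     (\<Sum>h\<in>multi_indices k. T j h *\<^sub>C tensor_power u k h i) =
     (\<Sum>h\<in>multi_indices l. T h i *\<^sub>C tensor_power u l j h)}"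

definition Fix :: "('n::finite \<Rightarrow> 'n \<Rightarrow> 'a::unital_cstar_algebra) \<Rightarrow> cint \<Rightarrow> 'n tmap set" where
  "Fix u k = tannakian u [] k"

section \<open>Presentation level\<close>

definition Fix_family ::
  "('n::finite \<Rightarrow> 'n \<Rightarrow> 'a::unital_cstar_algebra) \<Rightarrow> nat \<Rightarrow> 'n tfamily" where
  "Fix_family u r k l = (if k = [] \<and> length l = r then Fix u l else {})"

text \<open>Both levels range over the positive integers; an infimum over the empty set is \<open>\<infinity>\<close>.\<close>

definition presentation_level ::
  "('n::finite \<Rightarrow> 'n \<Rightarrow> 'a::unital_cstar_algebra) \<Rightarrow> enat" where
  "presentation_level u =
     (INF r \<in> {r. 1 \<le> r \<and> tannakian u = generated_category (Fix_family u r)}. enat r)"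

definition dual_finitely_presented ::
  "('n::finite \<Rightarrow> 'n \<Rightarrow> 'a::unital_cstar_algebra) \<Rightarrow> bool" where
  "dual_finitely_presented u \<longleftrightarrow> presentation_level u < \<infinity>"

section \<open>Easiness level\<close>

text \<open>Upper points are tagged \<open>Inl\<close>, lower points \<open>Inr\<close>.\<close>

definition partitions :: "cint \<Rightarrow> cint \<Rightarrow> (nat + nat) set set set" where
  "partitions k l = {\<pi>. partition_on ({..<length k} <+> {..<length l}) \<pi>}"

definition T_part :: "cint \<Rightarrow> cint \<Rightarrow> (nat + nat) set set \<Rightarrow> 'n tmap" where
  "T_part k l \<pi> = (\<lambda>j i. of_bool (length j = length l \<and> length i = length k \<and>
     (\<forall>B\<in>\<pi>. \<exists>a. \<forall>x\<in>B. case_sum (nth i) (nth j) x = a)))"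

definition E_family ::
  "('n::finite \<Rightarrow> 'n \<Rightarrow> 'a::unital_cstar_algebra) \<Rightarrow> nat \<Rightarrow> 'n tfamily" where
  "E_family u p k l = {T \<in> tannakian u k l. \<exists>\<alpha> \<pi>. (\<forall>m<p. \<pi> m \<in> partitions k l) \<and>
     T = (\<lambda>j i. \<Sum>m<p. \<alpha> m * T_part k l (\<pi> m) j i)}"

definition easiness_category ::
  "('n::finite \<Rightarrow> 'n \<Rightarrow> 'a::unital_cstar_algebra) \<Rightarrow> nat \<Rightarrow> 'n tfamily" where
  "easiness_category u p = generated_category (E_family u p)"

text \<open>\<open>G\<^sup>p\<close> is by definition the closed subgroup of \<open>U\<^sub>N\<^sup>+\<close> whose Tannakian category is
  \<open>C\<^sup>p = easiness_category u p\<close>, so \<open>G = G\<^sup>p\<close> says that the Tannakian category of \<open>G\<close> is \<open>C\<^sup>p\<close>.\<close>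

definition easiness_level ::
  "('n::finite \<Rightarrow> 'n \<Rightarrow> 'a::unital_cstar_algebra) \<Rightarrow> enat" where
  "easiness_level u = (INF p \<in> {p. 1 \<le> p \<and> tannakian u = easiness_category u p}. enat p)"

definition bell :: "nat \<Rightarrow> nat" where
  "bell r = card {P. partition_on {..<r} P}"

end

theory Submission
  imports Defs
begin

text \<open>
  Let \<open>C\<close> be the Tannakian category of \<open>G\<close>. Since \<open>S\<^sub>N \<subseteq> G\<close>, every \<open>T \<in> C(k,l)\<close> intertwines the
  permutation matrices, so its entries \<open>T\<^sub>j\<^sub>i\<close> are invariant under simultaneous relabelling of all
  indices in \<open>i\<close> and \<open>j\<close> (\<open>tannakian_permutation_invariant\<close>). Two pairs \<open>(i,j)\<close> lie in the same
  orbit of this action as soon as they have the same kernel, the equivalence relation that joins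
  the positions carrying equal indices (\<open>same_kernel_imp_permutation\<close>). Hence \<open>T\<^sub>j\<^sub>i\<close> depends only
  on the kernel of \<open>(i,j)\<close>. On the other hand, \<open>T\<^sub>\<pi>\<close> is the indicator of the kernels that contain
  the relation of \<open>\<pi>\<close>, and Moebius inversion (\<open>Moebius_inversion_subsets\<close>) writes any function of
  kernels in terms of these indicators. There are \<open>B\<^sub>r\<close> partitions of \<open>r = |k| + |l|\<close> points, so
  \<open>E\<^sup>p(k,l) = C(k,l)\<close> for \<open>p = B\<^sub>r\<close> (\<open>tannakian_subset_E_family\<close>).

  If now \<open>C\<close> is generated by the spaces \<open>Fix(u\<^sup>\<otimes>\<^sup>k)\<close> with \<open>|k| = r\<close>, then \<open>Fix(u\<^sup>\<otimes>\<^sup>k) \<subseteq> E\<^sup>p \<subseteq> C\<close>,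
  and therefore \<open>E\<^sup>p\<close> generates \<open>C\<close> as well.
  This last step only uses that \<open><\<cdot>>\<close> is a closure operator.
\<close>

section \<open>Generated categories\<close>

lemma generated_category_superset: "X k l \<subseteq> generated_category X k l"
  unfolding generated_category_def by blast

lemma generated_category_least:
  assumes "\<And>k l. X k l \<subseteq> generated_category Y k l"
  shows "generated_category X k l \<subseteq> generated_category Y k l"
  using assms unfolding generated_category_def by blast

section \<open>Functions of kernels and partitions\<close>

text \<open>Moebius inversion on a finite family of sets ordered by inclusion. The coefficients are
  found recursively, a maximal member \<open>M\<close> coming last: its coefficient only affects the equation
  at \<open>M\<close> itself.\<close>

lemma Moebius_inversion_subsets:
  fixes g :: "'s set \<Rightarrow> 'c::ring_1"
  assumes "finite F"
  shows "\<exists>\<alpha>. \<forall>A\<in>F. g A = (\<Sum>B\<in>F. \<alpha> B * of_bool (B \<subseteq> A))"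
  using assms
proof (induction "card F" arbitrary: F)
  case 0
  then show ?case by simp
next
  case (Suc n)
  then have "F \<noteq> {}" by auto
  then obtain M where M: "M \<in> F" "\<And>A. A \<in> F \<Longrightarrow> M \<subseteq> A \<Longrightarrow> A = M"
    using finite_has_maximal[OF \<open>finite F\<close>] by metis
  have "n = card (F - {M})" "finite (F - {M})"
    using Suc.hyps(2) Suc.prems M(1) by simp_all
  then obtain \<alpha> where \<alpha>: "\<And>A. A \<in> F - {M} \<Longrightarrow> g A = (\<Sum>B\<in>F - {M}. \<alpha> B * of_bool (B \<subseteq> A))"
    using Suc.hyps(1) by metis
  define \<beta> where "\<beta> = \<alpha>(M := g M - (\<Sum>B\<in>F - {M}. \<alpha> B * of_bool (B \<subseteq> M)))"
  have "(\<Sum>B\<in>F. \<beta> B * of_bool (B \<subseteq> A)) =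
      \<beta> M * of_bool (M \<subseteq> A) + (\<Sum>B\<in>F - {M}. \<alpha> B * of_bool (B \<subseteq> A))" for A
    unfolding sum.remove[OF Suc.prems M(1)] by (auto simp: \<beta>_def intro!: sum.cong)
  then have "g A = (\<Sum>B\<in>F. \<beta> B * of_bool (B \<subseteq> A))" if "A \<in> F" for A
    using \<alpha>[of A] M(2)[OF that] that by (cases "A = M") (auto simp: \<beta>_def)
  then show ?case by blast
qed

text \<open>The equivalence relation whose classes are the blocks of \<open>P\<close>.\<close>

definition partition_rel :: "'p set set \<Rightarrow> ('p \<times> 'p) set" where
  "partition_rel P = {(x, y). \<exists>B\<in>P. x \<in> B \<and> y \<in> B}"

text \<open>The kernel of a function on \<open>A\<close>.\<close>

definition kernel_rel :: "'p set \<Rightarrow> ('p \<Rightarrow> 'v) \<Rightarrow> ('p \<times> 'p) set" where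
  "kernel_rel A v = {(x, y). x \<in> A \<and> y \<in> A \<and> v x = v y}"

lemma inj_on_partition_rel: "inj_on partition_rel {P. partition_on A P}"
  by (rule inj_on_inverseI[where g = "\<lambda>R. A // R"])
    (simp add: partition_rel_def partition_on_eq_quotient)

lemma kernel_rel_in_partition_rels: "kernel_rel A v \<in> partition_rel ` {P. partition_on A P}"
proof
  define P where "P = A // kernel_rel A v"
  have eq: "equiv A (kernel_rel A v)"
    by (rule equivI) (auto simp: kernel_rel_def refl_on_def sym_def trans_def)
  then show "P \<in> {P. partition_on A P}"
    by (simp add: P_def partition_on_quotient)
  show "kernel_rel A v = partition_rel P"
    using eq unfolding P_def partition_rel_def
    by (auto simp: kernel_rel_def quotient_def)
qed

lemma partition_rel_subset_kernel_rel_iff: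
  assumes "partition_on A P"
  shows "partition_rel P \<subseteq> kernel_rel A v \<longleftrightarrow> (\<forall>B\<in>P. \<exists>a. \<forall>x\<in>B. v x = a)"
proof -
  have "B \<subseteq> A" if "B \<in> P" for B
    using partition_onD1[OF assms] that by blast
  then have "partition_rel P \<subseteq> kernel_rel A v \<longleftrightarrow> (\<forall>B\<in>P. \<forall>x\<in>B. \<forall>y\<in>B. v x = v y)"
    unfolding partition_rel_def kernel_rel_def by blast
  also have "\<dots> \<longleftrightarrow> (\<forall>B\<in>P. \<exists>a. \<forall>x\<in>B. v x = a)"
    by metis
  finally show ?thesis .
qed

text \<open>The condition in \<open>of_bool\<close>, that \<open>v\<close> is constant on the blocks of \<open>P\<close>, is the condition
  \<open>\<delta>\<^sub>P(v) = 1\<close> defining \<open>T\<^sub>P\<close>. So the functions \<open>\<delta>\<^sub>P\<close> span all functions of kernels.\<close>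

lemma kernel_function_sum_partitions:
  fixes f :: "('p \<Rightarrow> 'v) \<Rightarrow> 'c::ring_1"
  assumes "finite A"
    and f: "\<And>v w. v \<in> V \<Longrightarrow> w \<in> V \<Longrightarrow> kernel_rel A v = kernel_rel A w \<Longrightarrow> f v = f w"
  shows "\<exists>\<alpha>. \<forall>v\<in>V.
    f v = (\<Sum>P | partition_on A P. \<alpha> P * of_bool (\<forall>B\<in>P. \<exists>a. \<forall>x\<in>B. v x = a))"
proof -
  define g where "g R = f (SOME v. v \<in> V \<and> kernel_rel A v = R)" for R
  have g: "g (kernel_rel A v) = f v" if "v \<in> V" for v
  proof -
    have "\<exists>w. w \<in> V \<and> kernel_rel A w = kernel_rel A v"
      using that by blast
    then have "(SOME w. w \<in> V \<and> kernel_rel A w = kernel_rel A v) \<in> V \<and>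
        kernel_rel A (SOME w. w \<in> V \<and> kernel_rel A w = kernel_rel A v) = kernel_rel A v"
      by (rule someI_ex)
    then show ?thesis
      unfolding g_def using f[OF _ that] by blast
  qed
  let ?F = "partition_rel ` {P. partition_on A P}"
  have "finite ?F"
    using finitely_many_partition_on[OF \<open>finite A\<close>] by simp
  then obtain \<alpha> where \<alpha>: "\<And>R. R \<in> ?F \<Longrightarrow> g R = (\<Sum>Q\<in>?F. \<alpha> Q * of_bool (Q \<subseteq> R))"
    using Moebius_inversion_subsets by metis
  have "f v = (\<Sum>P | partition_on A P.
      \<alpha> (partition_rel P) * of_bool (\<forall>B\<in>P. \<exists>a. \<forall>x\<in>B. v x = a))" if "v \<in> V" for v
  proof -
    have "f v = (\<Sum>Q\<in>?F. \<alpha> Q * of_bool (Q \<subseteq> kernel_rel A v))"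
      using \<alpha>[OF kernel_rel_in_partition_rels] g[OF that] by metis
    also have "\<dots> = (\<Sum>P | partition_on A P.
        \<alpha> (partition_rel P) * of_bool (partition_rel P \<subseteq> kernel_rel A v))"
      by (simp add: sum.reindex[OF inj_on_partition_rel])
    finally show ?thesis
      by (simp add: partition_rel_subset_kernel_rel_iff)
  qed
  then show ?thesis
    by (intro exI[of _ "\<lambda>P. \<alpha> (partition_rel P)"]) blast
qed

section \<open>Orbits of multi-indices\<close>

lemma same_kernel_imp_permutation:
  fixes v w :: "'p \<Rightarrow> 'v::finite"
  assumes "kernel_rel A v = kernel_rel A w"
  shows "\<exists>\<sigma>. \<sigma> permutes UNIV \<and> (\<forall>x\<in>A. w x = \<sigma> (v x))"
proof -
  have ker: "v x = v y \<longleftrightarrow> w x = w y" if "x \<in> A" "y \<in> A" for x y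
    using assms that by (auto simp: kernel_rel_def set_eq_iff)
  (* The bijection v(x) \<mapsto> w(x) between the images is extended by any bijection of the complements. *)
  define \<tau> where "\<tau> a = w (SOME x. x \<in> A \<and> v x = a)" for a
  have \<tau>: "\<tau> (v x) = w x" if "x \<in> A" for x
  proof -
    have "(SOME y. y \<in> A \<and> v y = v x) \<in> A \<and> v (SOME y. y \<in> A \<and> v y = v x) = v x"
      by (rule someI[of _ x]) (simp add: that)
    then show ?thesis unfolding \<tau>_def using ker that by blast
  qed
  then have bij1: "bij_betw \<tau> (v ` A) (w ` A)"
    unfolding bij_betw_def inj_on_def using ker by (force simp: image_iff)
  then have "card (- (v ` A)) = card (- (w ` A))"
    by (simp add: Compl_eq_Diff_UNIV card_Diff_subset bij_betw_same_card)
  then obtain \<rho> where bij2: "bij_betw \<rho> (- (v ` A)) (- (w ` A))"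
    using finite_same_card_bij[of "- (v ` A)" "- (w ` A)"] by auto
  define \<sigma> where "\<sigma> a = (if a \<in> v ` A then \<tau> a else \<rho> a)" for a
  have "bij_betw \<sigma> (v ` A \<union> - (v ` A)) (w ` A \<union> - (w ` A))"
    using bij_betw_disjoint_Un[OF bij1 bij2] unfolding \<sigma>_def by simp
  then have "\<sigma> permutes UNIV"
    by (intro bij_imp_permutes) simp_all
  moreover have "\<forall>x\<in>A. w x = \<sigma> (v x)"
    by (simp add: \<sigma>_def \<tau>)
  ultimately show "\<exists>\<sigma>. \<sigma> permutes UNIV \<and> (\<forall>x\<in>A. w x = \<sigma> (v x))" by blast
qed

section \<open>Bell numbers\<close>

lemma card_partitions_bij_le:
  assumes "bij_betw f A B" "finite B"
  shows "card {P. partition_on A P} \<le> card {P. partition_on B P}"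
proof (rule card_inj_on_le)
  show "(`) ((`) f) ` {P. partition_on A P} \<subseteq> {P. partition_on B P}"
  proof clarify
    fix P assume P: "partition_on A P"
    then have "{} \<notin> (`) f ` P"
      by (auto simp: partition_on_def)
    then show "partition_on B ((`) f ` P)"
      using partition_on_inj_image[OF P, of f] assms(1) by (simp add: bij_betw_def)
  qed
  have "inj_on ((`) ((`) f)) (Pow (Pow A))"
    using assms(1) by (intro inj_on_image_Pow) (simp add: bij_betw_def)
  then show "inj_on ((`) ((`) f)) {P. partition_on A P}"
    by (rule inj_on_subset) (auto simp: partition_on_def)
  show "finite {P. partition_on B P}"
    by (rule finitely_many_partition_on[OF assms(2)])
qed

lemma card_partitions_bell:
  assumes "finite A"
  shows "card {P. partition_on A P} = bell (card A)"
proof -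
  obtain f where f: "bij_betw f A {..<card A}"
    using ex_bij_betw_finite_nat[OF assms] by (auto simp: atLeast0LessThan)
  show ?thesis
    unfolding bell_def using assms
    by (intro antisym card_partitions_bij_le[OF f] card_partitions_bij_le[OF bij_betw_inv_into[OF f]])
      simp_all
qed

lemma bell_pos: "1 \<le> bell r"
proof -
  have "{P. partition_on {..<r} P} \<noteq> {}"
    using partition_on_singletons by blast
  then have "0 < card {P. partition_on {..<r} P}"
    by (simp add: card_gt_0_iff finitely_many_partition_on)
  then show ?thesis by (simp add: bell_def)
qed

section \<open>Intertwiners of homogeneous quantum groups\<close>

lemma star_hom_sum_scaleC:
  assumes "star_hom f"
  shows "f (\<Sum>h\<in>A. c h *\<^sub>C x h) = (\<Sum>h\<in>A. c h *\<^sub>C f (x h))"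
proof -
  have "f 0 = 0"
    using assms unfolding star_hom_def by (metis add_cancel_right_right)
  then show ?thesis
    using assms by (induction A rule: infinite_finite_induct) (auto simp: star_hom_def)
qed

text \<open>At a permutation \<open>\<sigma>\<close>, the matrix \<open>u\<^sup>\<otimes>\<^sup>k\<close> becomes the permutation matrix of \<open>\<sigma>\<close> acting on
  multi-indices, whatever the colors.\<close>

lemma star_hom_tensor_power_permutation:
  fixes f :: "'a::unital_cstar_algebra \<Rightarrow> complex"
  assumes "star_hom f" "\<And>i j. f (u i j) = of_bool (i = \<sigma> j)"
    and "length i = length k" "length j = length k"
  shows "f (tensor_power u k i j) = of_bool (i = map \<sigma> j)"
  using assms(3,4)
proof (induction k arbitrary: i j)
  case Nil
  then show ?case using assms(1) by (simp add: star_hom_def)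
next
  case (Cons c k)
  then obtain a i' b j' where ij: "i = a # i'" "j = b # j'"
    by (metis length_Suc_conv list.size(4) add_Suc_right add_0_right)
  have "f (colored_entry u c a b) = of_bool (a = \<sigma> b)"
    using assms(1,2) by (cases c) (auto simp: star_hom_def star_complex_def)
  then show ?case
    using Cons ij assms(1) by (auto simp: star_hom_def)
qed

lemma finite_multi_indices: "finite (multi_indices k :: 'n::finite list set)"
  using finite_lists_length_eq[of "UNIV :: 'n set" "length k"] by (simp add: multi_indices_def)

lemma tannakian_permutation_invariant:
  fixes u :: "'n::finite \<Rightarrow> 'n \<Rightarrow> 'a::unital_cstar_algebra"
  assumes "contains_SN u" "T \<in> tannakian u k l" "\<sigma> permutes UNIV"
    and len: "length j = length l" "length i = length k"
  shows "T (map \<sigma> j) (map \<sigma> i) = T j i"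
proof -
  obtain f :: "'a \<Rightarrow> complex" where f: "star_hom f" "\<And>a b. f (u a b) = of_bool (a = \<sigma> b)"
    using assms(1,3) unfolding contains_SN_def by metis
  note tp = star_hom_tensor_power_permutation[OF f]
  have inj: "inj (map \<sigma>)"
    using assms(3) by (simp add: permutes_inj)
  have ij: "map \<sigma> i \<in> multi_indices k" "j \<in> multi_indices l"
    using len by (simp_all add: multi_indices_def)
  (* Evaluate the intertwining relation at the entry in row \<sigma>(j) and column i. *)
  have "f (\<Sum>h\<in>multi_indices k. T (map \<sigma> j) h *\<^sub>C tensor_power u k h i) =
      f (\<Sum>h\<in>multi_indices l. T h i *\<^sub>C tensor_power u l (map \<sigma> j) h)"
    using assms(2) len by (simp add: tannakian_def multi_indices_def)
  then have "(\<Sum>h\<in>multi_indices k. T (map \<sigma> j) h * of_bool (h = map \<sigma> i)) =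
      (\<Sum>h\<in>multi_indices l. T h i * of_bool (map \<sigma> j = map \<sigma> h))"
    unfolding star_hom_sum_scaleC[OF f(1)] using len
    by (simp add: tp multi_indices_def scaleC_complex_def)
  moreover have "(\<Sum>h\<in>multi_indices k. T (map \<sigma> j) h * of_bool (h = map \<sigma> i)) =
      T (map \<sigma> j) (map \<sigma> i)"
    using ij by (simp add: of_bool_def if_distrib finite_multi_indices cong: if_cong)
  moreover have "(\<Sum>h\<in>multi_indices l. T h i * of_bool (map \<sigma> j = map \<sigma> h)) = T j i"
    using ij inj_eq[OF inj]
    by (simp add: of_bool_def if_distrib finite_multi_indices cong: if_cong)
  ultimately show ?thesis by simp
qed

lemma tannakian_same_kernel:
  fixes u :: "'n::finite \<Rightarrow> 'n \<Rightarrow> 'a::unital_cstar_algebra"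
  assumes "contains_SN u" "T \<in> tannakian u k l"
    and len: "length j = length l" "length i = length k" "length j' = length l" "length i' = length k"
    and ker: "kernel_rel ({..<length k} <+> {..<length l}) (case_sum (nth i) (nth j)) =
      kernel_rel ({..<length k} <+> {..<length l}) (case_sum (nth i') (nth j'))"
  shows "T j i = T j' i'"
proof -
  obtain \<sigma> where \<sigma>: "\<sigma> permutes UNIV"
    and eq: "\<And>x. x \<in> {..<length k} <+> {..<length l} \<Longrightarrow>
      case_sum (nth i') (nth j') x = \<sigma> (case_sum (nth i) (nth j) x)"
    using same_kernel_imp_permutation[OF ker] by blast
  have "i' = map \<sigma> i"
    using eq[OF InlI] len by (intro nth_equalityI) auto
  moreover have "j' = map \<sigma> j"
    using eq[OF InrI] len by (intro nth_equalityI) auto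
  ultimately show ?thesis
    using tannakian_permutation_invariant[OF assms(1,2) \<sigma> len(1,2)] by simp
qed

lemma tannakian_sum_T_part:
  fixes u :: "'n::finite \<Rightarrow> 'n \<Rightarrow> 'a::unital_cstar_algebra"
  assumes "contains_SN u" "T \<in> tannakian u k l"
  obtains \<alpha> where "T = (\<lambda>j i. \<Sum>\<pi>\<in>partitions k l. \<alpha> \<pi> * T_part k l \<pi> j i)"
proof -
  let ?A = "{..<length k} <+> {..<length l}"
  let ?v = "\<lambda>(j :: 'n list, i). case_sum (nth i) (nth j)"
  let ?L = "{(j :: 'n list, i :: 'n list). length j = length l \<and> length i = length k}"
  (* T as a function of v alone: by tannakian_same_kernel, the choice of (j, i) is immaterial. *)
  define f where "f v = (case SOME ji. ji \<in> ?L \<and> ?v ji = v of (j, i) \<Rightarrow> T j i)" for v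
  have same: "T j i = T j' i'" if "(j, i) \<in> ?L" "(j', i') \<in> ?L"
    "kernel_rel ?A (?v (j, i)) = kernel_rel ?A (?v (j', i'))" for j i j' i'
    using that by (intro tannakian_same_kernel[OF assms]) auto
  have f: "f (?v (j, i)) = T j i" if "(j, i) \<in> ?L" for j i
  proof -
    obtain j' i' where ji: "(SOME ji. ji \<in> ?L \<and> ?v ji = ?v (j, i)) = (j', i')"
      by fastforce
    have "(j', i') \<in> ?L \<and> ?v (j', i') = ?v (j, i)"
      unfolding ji[symmetric] by (rule someI[of _ "(j, i)"]) (use that in simp)
    then show ?thesis
      unfolding f_def ji using that by (auto intro!: same)
  qed
  have f_cong: "f v = f w" if vw: "v \<in> ?v ` ?L" "w \<in> ?v ` ?L" "kernel_rel ?A v = kernel_rel ?A w" for v w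
  proof -
    obtain j i j' i' where "(j, i) \<in> ?L" "v = ?v (j, i)" "(j', i') \<in> ?L" "w = ?v (j', i')"
      using vw(1,2) by blast
    then show ?thesis using same vw(3) f by metis
  qed
  have "\<exists>\<alpha>. \<forall>v\<in>?v ` ?L.
      f v = (\<Sum>P | partition_on ?A P. \<alpha> P * of_bool (\<forall>B\<in>P. \<exists>a. \<forall>x\<in>B. v x = a))"
    by (intro kernel_function_sum_partitions finite_Plus finite_lessThan f_cong)
  then obtain \<alpha> where \<alpha>: "\<forall>v\<in>?v ` ?L.
      f v = (\<Sum>P | partition_on ?A P. \<alpha> P * of_bool (\<forall>B\<in>P. \<exists>a. \<forall>x\<in>B. v x = a))"
    by (rule exE)
  have "T j i = (\<Sum>\<pi>\<in>partitions k l. \<alpha> \<pi> * T_part k l \<pi> j i)" for j i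
  proof (cases "(j, i) \<in> ?L")
    case True
    then show ?thesis
      using \<alpha>[rule_format, OF imageI[OF True]] f[OF True] by (simp add: T_part_def partitions_def)
  next
    case False
    then have "T j i = 0"
      using assms(2) unfolding tannakian_def tmaps_def by blast
    then show ?thesis
      using False by (auto simp: T_part_def)
  qed
  then show thesis by (intro that ext)
qed

lemma tannakian_subset_E_family:
  fixes u :: "'n::finite \<Rightarrow> 'n \<Rightarrow> 'a::unital_cstar_algebra"
  assumes "contains_SN u"
  shows "tannakian u k l \<subseteq> E_family u (bell (length k + length l)) k l"
proof
  fix T assume T: "T \<in> tannakian u k l"
  let ?p = "bell (length k + length l)"
  obtain \<alpha> where \<alpha>: "T = (\<lambda>j i. \<Sum>\<pi>\<in>partitions k l. \<alpha> \<pi> * T_part k l \<pi> j i)"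
    using tannakian_sum_T_part[OF assms T] .
  have "finite (partitions k l)" "card (partitions k l) = ?p"
    unfolding partitions_def
    by (simp_all add: finitely_many_partition_on card_partitions_bell card_Plus)
  then obtain \<pi> where \<pi>: "bij_betw \<pi> {..<?p} (partitions k l)"
    using ex_bij_betw_nat_finite[of "partitions k l"] by (auto simp: atLeast0LessThan)
  have "T = (\<lambda>j i. \<Sum>m<?p. \<alpha> (\<pi> m) * T_part k l (\<pi> m) j i)"
    unfolding \<alpha> by (intro ext sum.reindex_bij_betw[OF \<pi>, symmetric])
  moreover have "\<forall>m<?p. \<pi> m \<in> partitions k l"
    using bij_betwE[OF \<pi>] by simp
  ultimately have "(\<forall>m<?p. \<pi> m \<in> partitions k l) \<and>
      T = (\<lambda>j i. \<Sum>m<?p. (\<alpha> \<circ> \<pi>) m * T_part k l (\<pi> m) j i)"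
    by simp
  then show "T \<in> E_family u ?p k l"
    using T unfolding E_family_def mem_Collect_eq
    by (intro conjI exI[of _ "\<alpha> \<circ> \<pi>"] exI[of _ \<pi>]) simp_all
qed

section \<open>Presentation level and easiness level\<close>

lemma tannakian_eq_easiness_category:
  fixes u :: "'n::finite \<Rightarrow> 'n \<Rightarrow> 'a::unital_cstar_algebra"
  assumes "contains_SN u" and gen: "tannakian u = generated_category (Fix_family u r)"
  shows "tannakian u = easiness_category u (bell r)"
proof (intro ext antisym)
  fix k l
  (* A fixed vector has no upper points, so the lower word alone has length r. *)
  have "Fix_family u r k' l' \<subseteq> E_family u (bell r) k' l'" for k' l'
    using tannakian_subset_E_family[OF assms(1), of "[]" l'] by (auto simp: Fix_family_def Fix_def)
  then show "tannakian u k l \<subseteq> easiness_category u (bell r) k l"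
    unfolding gen easiness_category_def
    by (intro generated_category_least) (meson generated_category_superset order_trans)
  have "E_family u (bell r) k' l' \<subseteq> tannakian u k' l'" for k' l'
    by (auto simp: E_family_def)
  then show "easiness_category u (bell r) k l \<subseteq> tannakian u k l"
    unfolding easiness_category_def gen[symmetric]
    by (subst gen, intro generated_category_least) (simp add: gen[symmetric])
qed

text \<open>A finite infimum of natural numbers is attained.\<close>

lemma presentation_level_attained:
  assumes "presentation_level u = enat r"
  shows "tannakian u = generated_category (Fix_family u r)"
proof -
  let ?R = "{r. 1 \<le> r \<and> tannakian u = generated_category (Fix_family u r)}"
  have "?R \<noteq> {}"
  proof
    assume "?R = {}"
    then have "presentation_level u = \<infinity>"
      unfolding presentation_level_def by (simp only: image_empty Inf_empty top_enat_def)
    then show False using assms by simp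
  qed
  then obtain s where "s \<in> ?R" by blast
  then have "enat r \<in> enat ` ?R"
    unfolding assms[symmetric] presentation_level_def by (intro wellorder_InfI) blast
  then show ?thesis by blast
qed

theorem proposition3p5:
  fixes u :: "'n::finite \<Rightarrow> 'n \<Rightarrow> 'a::unital_cstar_algebra"
    and t :: "'a \<Rightarrow> 'a \<Rightarrow> 'b::unital_cstar_algebra"
    and \<Delta> :: "'a \<Rightarrow> 'b" and \<epsilon> :: "'a \<Rightarrow> complex" and S :: "'a \<Rightarrow> 'a"
  assumes "closed_subgroup_UN_plus t u \<Delta> \<epsilon> S"
    and "contains_SN u"
  shows "(\<forall>r. presentation_level u = enat r \<longrightarrow> easiness_level u \<le> enat (bell r)) \<and>
         (dual_finitely_presented u \<longrightarrow> easiness_level u < \<infinity>)"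
proof (rule conjI)
  show *: "\<forall>r. presentation_level u = enat r \<longrightarrow> easiness_level u \<le> enat (bell r)"
  proof (intro allI impI)
    fix r assume "presentation_level u = enat r"
    then have "tannakian u = easiness_category u (bell r)"
      using tannakian_eq_easiness_category[OF assms(2)] presentation_level_attained by blast
    then show "easiness_level u \<le> enat (bell r)"
      unfolding easiness_level_def using bell_pos by (intro INF_lower) simp
  qed
  show "dual_finitely_presented u \<longrightarrow> easiness_level u < \<infinity>"
  proof
    assume "dual_finitely_presented u"
    then obtain r where "presentation_level u = enat r"
      by (auto simp: dual_finitely_presented_def less_infinityE)
    then show "easiness_level u < \<infinity>"
      using * enat_ord_simps(4) order_le_less_trans by blast
  qed
qed

end
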